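(* Let $\tau>0$, $\Delta\in\mathbb{R}$, and $p=\frac{1}{1+e^{-\Delta/\tau}}$. For any truncation $M$, i.e. any random variable with values in $\{1,2,\dots\}$, independent of the comparison outcomes, the Russian-roulette estimator $\widehat\Delta=\tau\sum_{m=1}^{M}\frac{A_m-B_m}{m\,q_m}$ with $q_m:=\mathbb{P}(M\ge m)$ (defined in the context) satisfies $$\mathbb{E}[\widehat\Delta]=\Delta.$$
   Context: Logistic comparison model: for a pair $(x,y)$ with gap $\Delta=f(y)-f(x)$, each comparison returns an independent $\mathrm{Bernoulli}(p)$ outcome, $p=\frac1{1+e^{-\Delta/\tau}}$, where $\tau>0$ is the temperature. For each $m\le M$ a fresh block of $m$ i.i.d. $\mathrm{Bernoulli}(p)$ outcomes $Y^{(m)}_1,\dots,Y^{(m)}_m$ is used (blocks independent across $m$), and $A_m:=\mathbf{1}\{Y^{(m)}_1=\cdots=Y^{(m)}_m=1\}$, $B_m:=\mathbf{1}\{Y^{(m)}_1=\cdots=Y^{(m)}_m=0\}$.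
   Formalization: The formal statement additionally assumes q_m = P(M ≥ m) > 0 for every m ≥ 1; without it the claim fails, e.g. M = 1 almost surely gives mean τ(2p−1), which differs from Δ whenever Δ ≠ 0. *)

theory Defs
  imports "HOL-Probability.Probability"
begin

text \<open>
  Outcomes are Booleans: \<open>True\<close> is the outcome 1 and \<open>False\<close> the outcome 0. The outcome
  \<open>Y\<^sup>(\<^sup>m\<^sup>)\<^sub>i\<close> is written \<open>Y (m, i)\<close>. Blocks are indexed by all \<open>m \<ge> 1\<close>, although
  the estimator only ever reads those with \<open>m \<le> N\<close>, where \<open>N\<close> is the random truncation level.
\<close>

definition comparison_prob :: "real \<Rightarrow> real \<Rightarrow> real" where
  "comparison_prob \<tau> \<Delta> = 1 / (1 + exp (- \<Delta> / \<tau>))"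

definition outcome_index :: "(nat \<times> nat) set" where
  "outcome_index = (SIGMA m:{1..}. {1..m})"

definition all_ones :: "(nat \<times> nat \<Rightarrow> 'a \<Rightarrow> bool) \<Rightarrow> nat \<Rightarrow> 'a \<Rightarrow> real" where
  "all_ones Y m \<omega> = of_bool (\<forall>i\<in>{1..m}. Y (m, i) \<omega> = True)"

definition all_zeros :: "(nat \<times> nat \<Rightarrow> 'a \<Rightarrow> bool) \<Rightarrow> nat \<Rightarrow> 'a \<Rightarrow> real" where
  "all_zeros Y m \<omega> = of_bool (\<forall>i\<in>{1..m}. Y (m, i) \<omega> = False)"

definition tail_prob :: "'a measure \<Rightarrow> ('a \<Rightarrow> nat) \<Rightarrow> nat \<Rightarrow> real" where
  "tail_prob P N m = measure P {\<omega> \<in> space P. N \<omega> \<ge> m}"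

definition roulette_estimator ::
  "'a measure \<Rightarrow> real \<Rightarrow> ('a \<Rightarrow> nat) \<Rightarrow> (nat \<times> nat \<Rightarrow> 'a \<Rightarrow> bool) \<Rightarrow> 'a \<Rightarrow> real" where
  "roulette_estimator P \<tau> N Y \<omega> =
     \<tau> * (\<Sum>m = 1..N \<omega>. (all_ones Y m \<omega> - all_zeros Y m \<omega>) / (real m * tail_prob P N m))"

text \<open>
  The library's \<open>indep_var\<close> requires both random variables to take values in the same type.
  This is the same notion (independence of the generated sigma-algebras) for two value types.
\<close>

definition (in prob_space) indep_var2 ::
  "'b measure \<Rightarrow> ('a \<Rightarrow> 'b) \<Rightarrow> 'c measure \<Rightarrow> ('a \<Rightarrow> 'c) \<Rightarrow> bool" where
  "indep_var2 S X T Y \<longleftrightarrow>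
     random_variable S X \<and> random_variable T Y \<and>
     indep_set (sigma_sets (space M) {X -` A \<inter> space M |A. A \<in> sets S})
               (sigma_sets (space M) {Y -` B \<inter> space M |B. B \<in> sets T})"

lemma (in prob_space) indep_var2_eq_indep_var:
  fixes X Y :: "'a \<Rightarrow> 'b"
  shows "indep_var2 S X T Y \<longleftrightarrow> indep_var S X T Y"
  unfolding indep_var2_def indep_var_eq by simp

end

theory Submission
  imports Defs
begin

text \<open>
  Weighting the \<open>m\<close>-th term by \<open>1 / P(N \<ge> m)\<close> undoes the truncation in expectation, so the
  estimator integrates to the full series \<open>\<tau> (\<Sum>m\<ge>1. (p^m - (1 - p)^m) / m)\<close>. By the Mercator
  series this is \<open>\<tau> (ln p - ln (1 - p))\<close>, the log-odds \<open>\<Delta>\<close> of the logistic model. The two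
  halves of the series have nonnegative terms, which justifies exchanging sum and expectation.
\<close>

text \<open>The logarithm series at \<open>- r\<close> with all signs flipped. It may start at
  \<open>m = 0\<close>, since that term is a division by zero and hence 0.\<close>

lemma mercator_sums:
  fixes r :: real
  assumes "\<bar>r\<bar> < 1"
  shows "(\<lambda>m. r ^ m / m) sums (- ln (1 - r))"
  using sums_minus[OF ln_series'[of "- r"]] assms by simp

lemma comparison_prob_bounds: "0 < comparison_prob \<tau> \<Delta>" "comparison_prob \<tau> \<Delta> < 1"
  by (simp_all add: comparison_prob_def add_pos_pos)

text \<open>The odds against the outcome 1 are exactly \<open>exp (- \<Delta> / \<tau>)\<close>, so
  taking logarithms recovers the gap up to the factor \<open>\<tau>\<close>.\<close>

lemma comparison_prob_log_odds:
  assumes "\<tau> \<noteq> 0"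
  shows "\<tau> * (ln (comparison_prob \<tau> \<Delta>) - ln (1 - comparison_prob \<tau> \<Delta>)) = \<Delta>"
proof -
  let ?p = "comparison_prob \<tau> \<Delta>"
  have pos: "1 + exp (- \<Delta> / \<tau>) > 0"
    by (simp add: add_pos_pos)
  have "1 - ?p = exp (- \<Delta> / \<tau>) * ?p"
    using pos by (simp add: comparison_prob_def field_simps)
  then have "ln (1 - ?p) = - \<Delta> / \<tau> + ln ?p"
    using comparison_prob_bounds(1)[of \<tau> \<Delta>] by (simp add: ln_mult)
  then show ?thesis
    using assms by (simp add: field_simps)
qed

text \<open>One half of the estimator, stated for a generic event family so that it serves for
  all-ones and all-zeros blocks alike. The factor \<open>tail_prob M N m\<close> in
  \<open>prob\<close> cancels the weight, leaving the Mercator terms.\<close>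

lemma (in prob_space) roulette_geometric:
  fixes N :: "'a \<Rightarrow> nat" and E :: "nat \<Rightarrow> 'a set" and r :: real
  assumes r: "0 \<le> r" "r < 1"
    and events: "\<And>m. m \<ge> 1 \<Longrightarrow> {\<omega> \<in> E m. m \<le> N \<omega>} \<in> events"
    and prob: "\<And>m. m \<ge> 1 \<Longrightarrow> prob {\<omega> \<in> E m. m \<le> N \<omega>} = tail_prob M N m * r ^ m"
    and q_pos: "\<And>m. m \<ge> 1 \<Longrightarrow> tail_prob M N m > 0"
  shows "has_bochner_integral M
    (\<lambda>\<omega>. \<Sum>m = 1..N \<omega>. indicator (E m) \<omega> / (m * tail_prob M N m)) (- ln (1 - r))"
proof -
  \<comment> \<open>Moving the condition \<open>m \<le> N \<omega>\<close> into the indicator turns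
    a sum of random length into a series over all \<open>m\<close>. Division by zero makes
    \<open>g 0\<close> vanish.\<close>
  define g where
    "g m \<omega> = indicator {\<omega> \<in> E m. m \<le> N \<omega>} \<omega> / (m * tail_prob M N m)" for m \<omega>
  have g: "has_bochner_integral M (g m) (r ^ m / m)" for m
  proof (cases "m = 0")
    case False
    then have "has_bochner_integral M (g m) (prob {\<omega> \<in> E m. m \<le> N \<omega>} / (m * tail_prob M N m))"
      unfolding g_def
      by (intro has_bochner_integral_divide_zero has_bochner_integral_real_indicator)
        (simp_all add: events less_top[symmetric])
    then show ?thesis
      using False prob[of m] q_pos[of m] by (simp add: field_simps)
  next
    case True
    then have "g m = (\<lambda>_. 0)"
      by (simp add: g_def fun_eq_iff)
    then show ?thesis
      using True by (simp add: has_bochner_integral_zero)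
  qed
  have finite_support: "g m \<omega> = 0" if "m \<notin> {1..N \<omega>}" for m \<omega>
    using that by (cases "m = 0") (auto simp: g_def)
  have nonneg: "norm (g m \<omega>) = g m \<omega>" for m \<omega>
    by (simp add: g_def tail_prob_def)
  have summable: "summable (\<lambda>m. norm (g m \<omega>))" for \<omega>
    using finite_support by (intro summable_finite[of "{1..N \<omega>}"]) auto
  have sums: "(\<lambda>m. r ^ m / m) sums (- ln (1 - r))"
    using mercator_sums r by simp
  have integral_g: "integrable M (g m)" "integral\<^sup>L M (g m) = r ^ m / m" for m
    using g[of m] by (simp_all add: has_bochner_integral_iff)
  \<comment> \<open>By nonnegativity the integrals of the norms are the terms
    \<open>r ^ m / m\<close> themselves, so convergence of the Mercator series licenses the
    exchange.\<close>
  have summable_integrals: "summable (\<lambda>m. \<integral>\<omega>. norm (g m \<omega>) \<partial>M)"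
    using sums by (simp add: nonneg integral_g sums_iff del: real_norm_def)
  have "has_bochner_integral M (\<lambda>\<omega>. \<Sum>m. g m \<omega>) (- ln (1 - r))"
    using integrable_suminf[OF integral_g(1) AE_I2[OF summable] summable_integrals]
      integral_suminf[OF integral_g(1) AE_I2[OF summable] summable_integrals] sums
    by (simp add: has_bochner_integral_iff integral_g sums_iff)
  moreover have "(\<Sum>m. g m \<omega>) = (\<Sum>m = 1..N \<omega>. indicator (E m) \<omega> / (m * tail_prob M N m))" for \<omega>
  proof -
    have "(\<Sum>m. g m \<omega>) = (\<Sum>m = 1..N \<omega>. g m \<omega>)"
      using finite_support by (intro suminf_finite) auto
    also have "\<dots> = (\<Sum>m = 1..N \<omega>. indicator (E m) \<omega> / (m * tail_prob M N m))"
      by (intro sum.cong) (auto simp: g_def indicator_def)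
    finally show ?thesis .
  qed
  ultimately show ?thesis
    by simp
qed

lemma (in prob_space) indep_var2D:
  assumes "indep_var2 S X T Y" "A \<in> sets S" "B \<in> sets T"
  shows "prob ((X -` A \<inter> space M) \<inter> (Y -` B \<inter> space M)) =
    prob (X -` A \<inter> space M) * prob (Y -` B \<inter> space M)"
  using assms unfolding indep_var2_def by (intro indep_setD) auto

lemma (in prob_space) prob_constant_block:
  assumes "indep_vars (\<lambda>_. count_space UNIV) Y K" "J \<subseteq> K" "finite J" "J \<noteq> {}"
    and distr: "\<And>k. k \<in> K \<Longrightarrow> distr M (count_space UNIV) (Y k) = measure_pmf D"
  shows "prob {\<omega> \<in> space M. \<forall>k\<in>J. Y k \<omega> = b} = pmf D b ^ card J"
proof -
  have single: "prob (Y k -` {b} \<inter> space M) = pmf D b" if "k \<in> K" for k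
  proof -
    have "random_variable (count_space UNIV) (Y k)"
      using assms(1) that by (simp add: indep_vars_def)
    then show ?thesis
      using arg_cong[OF distr[OF that], of "\<lambda>Q. measure Q {b}"]
      by (simp add: measure_distr measure_pmf_single)
  qed
  \<comment> \<open>Nonemptiness of \<open>J\<close> matters: an empty intersection would be
    \<open>UNIV\<close>, not \<open>space M\<close>.\<close>
  have "{\<omega> \<in> space M. \<forall>k\<in>J. Y k \<omega> = b} = (\<Inter>k\<in>J. Y k -` {b} \<inter> space M)"
    using assms(4) by auto
  also have "prob \<dots> = (\<Prod>k\<in>J. prob (Y k -` {b} \<inter> space M))"
    using assms by (intro indep_varsD[OF assms(1)]) auto
  also have "\<dots> = pmf D b ^ card J"
    using assms(2) single by (simp add: subset_eq)
  finally show ?thesis .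
qed

theorem lemma3p2:
  fixes P :: "'a measure"
    and \<tau> \<Delta> p :: real
    and N :: "'a \<Rightarrow> nat"
    and Y :: "nat \<times> nat \<Rightarrow> 'a \<Rightarrow> bool"
  assumes P: "prob_space P"
    and tau: "\<tau> > 0"
    and p: "p = comparison_prob \<tau> \<Delta>"
    and Y_bernoulli: "\<And>k. k \<in> outcome_index \<Longrightarrow>
          distr P (count_space UNIV) (Y k) = measure_pmf (bernoulli_pmf p)"
    and Y_indep: "prob_space.indep_vars P (\<lambda>_. count_space UNIV) Y outcome_index"
    and N_ge_1: "\<And>\<omega>. \<omega> \<in> space P \<Longrightarrow> N \<omega> \<ge> 1"
    and N_indep: "prob_space.indep_var2 P
          (count_space UNIV) N
          (Pi\<^sub>M outcome_index (\<lambda>_. count_space UNIV)) (\<lambda>\<omega>. \<lambda>k\<in>outcome_index. Y k \<omega>)"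
    and q_pos: "\<And>m. m \<ge> 1 \<Longrightarrow> tail_prob P N m > 0"
  shows "integrable P (roulette_estimator P \<tau> N Y)
       \<and> integral\<^sup>L P (roulette_estimator P \<tau> N Y) = \<Delta>"
proof -
  interpret prob_space P
    by (fact P)
  \<comment> \<open>The parameter \<open>b\<close> treats both outcomes at once: \<open>True\<close>
    gives the event behind \<open>all_ones\<close>, \<open>False\<close> the one behind
    \<open>all_zeros\<close>.\<close>
  define E where "E b m = {\<omega> \<in> space P. \<forall>i\<in>{1..m}. Y (m, i) \<omega> = b}" for b m
  define block where "block m = Pair m ` {1..m}" for m :: nat
  have block: "block m \<subseteq> outcome_index" if "m \<ge> 1" for m
    using that by (auto simp: block_def outcome_index_def)
  have E: "{\<omega> \<in> E b m. m \<le> N \<omega>} \<in> events"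
    "prob {\<omega> \<in> E b m. m \<le> N \<omega>} = tail_prob P N m * pmf (bernoulli_pmf p) b ^ m"
    if m: "m \<ge> 1" for b m
  proof -
    let ?T = "Pi\<^sub>M outcome_index (\<lambda>_. count_space UNIV) :: (nat \<times> nat \<Rightarrow> bool) measure"
    let ?Y = "\<lambda>\<omega>. \<lambda>k\<in>outcome_index. Y k \<omega>"
    \<comment> \<open>\<open>N\<close> is independent of the outcome family as a single random
      element, so \<open>E b m\<close> has to be exhibited as the preimage of a measurable set of
      the product space. This cylinder constrains only finitely many coordinates.\<close>
    let ?C = "{y \<in> space ?T. \<forall>k\<in>block m. y k = b}"
    have comp: "(\<lambda>y. y k) \<in> measurable ?T (count_space UNIV)" if "k \<in> block m" for k
      using block[OF m] that by (intro measurable_component_singleton) auto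
    have C: "?C \<in> sets ?T"
    proof (intro sets.sets_Collect_finite_All)
      fix k assume "k \<in> block m"
      from measurable_sets[OF comp[OF this], of "{b}"]
      show "{y \<in> space ?T. y k = b} \<in> sets ?T"
        by (simp add: vimage_def Int_def conj_commute)
    qed (simp add: block_def)
    have rv: "random_variable (count_space UNIV) N" "random_variable ?T ?Y"
      using N_indep by (simp_all add: indep_var2_def)
    have EY: "E b m = ?Y -` ?C \<inter> space P"
      using block[OF m] by (auto simp: E_def block_def space_PiM)
    have NY: "{\<omega> \<in> E b m. m \<le> N \<omega>} = (N -` {m..} \<inter> space P) \<inter> (?Y -` ?C \<inter> space P)"
      unfolding EY by auto
    show "{\<omega> \<in> E b m. m \<le> N \<omega>} \<in> events"
      unfolding NY using rv C by (intro sets.Int measurable_sets) auto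
    have "prob {\<omega> \<in> E b m. m \<le> N \<omega>} = prob (N -` {m..} \<inter> space P) * prob (E b m)"
      unfolding NY unfolding EY by (intro indep_var2D[OF N_indep] C) simp
    also have "prob (N -` {m..} \<inter> space P) = tail_prob P N m"
      by (simp add: tail_prob_def vimage_def Int_def conj_commute)
    also have "prob (E b m) = pmf (bernoulli_pmf p) b ^ m"
    proof -
      have "E b m = {\<omega> \<in> space P. \<forall>k\<in>block m. Y k \<omega> = b}"
        by (simp add: E_def block_def)
      moreover have "card (block m) = m"
        by (simp add: block_def card_image inj_on_def)
      moreover have "finite (block m)" "block m \<noteq> {}"
        using m by (simp_all add: block_def)
      ultimately show ?thesis
        using prob_constant_block[OF Y_indep block[OF m] _ _ Y_bernoulli] by simp
    qed
    finally show "prob {\<omega> \<in> E b m. m \<le> N \<omega>} = tail_prob P N m * pmf (bernoulli_pmf p) b ^ m" .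
  qed
  have p01: "0 < p" "p < 1"
    unfolding p by (rule comparison_prob_bounds)+
  then have pmf: "0 \<le> pmf (bernoulli_pmf p) b" "pmf (bernoulli_pmf p) b < 1" for b
    by (cases b; simp)+
  define S where "S b \<omega> = (\<Sum>m = 1..N \<omega>. indicator (E b m) \<omega> / (m * tail_prob P N m))" for b \<omega>
  have S: "has_bochner_integral P (S b) (- ln (1 - pmf (bernoulli_pmf p) b))" for b
    unfolding S_def[abs_def] by (intro roulette_geometric pmf E q_pos)
  \<comment> \<open>The all-ones half contributes \<open>- ln (1 - p)\<close> and the all-zeros half
    \<open>- ln p\<close>.\<close>
  have "has_bochner_integral P (\<lambda>\<omega>. \<tau> * (S True \<omega> - S False \<omega>)) (\<tau> * (ln p - ln (1 - p)))"
    using has_bochner_integral_mult_right[of \<tau>, OF has_bochner_integral_diff[OF S[of True] S[of False]]]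
      p01 by simp
  \<comment> \<open>The restriction to \<open>space P\<close> is there because \<open>E b m\<close>
    is cut down to it, whereas \<open>all_ones\<close> and \<open>all_zeros\<close> are not; the
    integral only sees values on \<open>space P\<close>.\<close>
  moreover have "roulette_estimator P \<tau> N Y \<omega> = \<tau> * (S True \<omega> - S False \<omega>)" if "\<omega> \<in> space P" for \<omega>
    using that by (simp add: roulette_estimator_def S_def E_def all_ones_def all_zeros_def
        sum_subtractf[symmetric] diff_divide_distrib[symmetric] indicator_def)
  ultimately have "has_bochner_integral P (roulette_estimator P \<tau> N Y) (\<tau> * (ln p - ln (1 - p)))"
    by (simp cong: has_bochner_integral_cong)
  moreover have "\<tau> * (ln p - ln (1 - p)) = \<Delta>"
    unfolding p using tau by (intro comparison_prob_log_odds) simp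
  ultimately show ?thesis
    by (simp add: has_bochner_integral_iff)
qed

end
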